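(* Let $n,m\ge1$ be integers, $0<\alpha<nm$ and $0<\epsilon<\min\{\alpha,nm-\alpha\}$. There is a constant $C>0$, depending only on $n$, $m$, $\alpha$ and $\epsilon$, such that for every $\vec f=(f_1,\dots,f_m)$ with each $f_i$ a bounded function with compact support on $\mathbb{R}^n$, and every $x\in\mathbb{R}^n$, $$|\mathcal{I}_\alpha\vec f(x)|\le C\left(\mathcal{M}_{\alpha+\epsilon}\vec f(x)\;\mathcal{M}_{\alpha-\epsilon}\vec f(x)\right)^{1/2}.$$
   Context: Functions are measurable. The multilinear fractional integral is $\mathcal{I}_\alpha\vec f(x)=\int_{(\mathbb{R}^n)^m}\frac{f_1(y_1)\cdots f_m(y_m)}{(|x-y_1|+\dots+|x-y_m|)^{mn-\alpha}}\,d\vec y$. For $0<\beta<nm$, $\mathcal{M}_\beta\vec f(x)=\sup_{Q\ni x}|Q|^{\beta/n}\prod_{i=1}^m\frac1{|Q|}\int_Q|f_i|$, the supremum over all cubes $Q$ (sides parallel to the axes) containing $x$. *)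

theory Defs
  imports "HOL-Analysis.Analysis"
begin

text \<open>
  An \<open>m\<close>-tuple of functions is a family \<open>f :: nat \<Rightarrow> real ^ 'n \<Rightarrow> complex\<close> of which only the
  members with index \<open>i < m\<close> matter; real-valued functions are the special case of values in
  \<open>\<real>\<close>.
\<close>

text \<open>
  The integral over \<open>(\<real>\<^sup>n)\<^sup>m\<close> is taken with respect to the product of \<open>m\<close> copies of
  Lebesgue measure. If all \<open>f i\<close> are Lebesgue measurable, the integrand is measurable for this
  product, so passing to its completion (Lebesgue measure in dimension \<open>m n\<close>) would not change the
  integral. At the single point where the denominator vanishes the integrand is \<open>0\<close> by
  convention; this is a null set as soon as \<open>m \<ge> 1\<close>.
\<close>

definition frac_integral ::
    "nat \<Rightarrow> real \<Rightarrow> (nat \<Rightarrow> real ^ 'n \<Rightarrow> complex) \<Rightarrow> real ^ 'n \<Rightarrow> complex" where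
  "frac_integral m \<alpha> f x =
     (LINT y | Pi\<^sub>M {..<m} (\<lambda>_. lebesgue).
        (\<Prod>i<m. f i (y i)) /
        of_real ((\<Sum>i<m. norm (x - y i)) powr (real m * real CARD('n) - \<alpha>)))"

definition cubes :: "(real ^ 'n) set set" where
  "cubes = {cbox a (a + vec h) | a h. h > 0}"

text \<open>
  The maximal function takes values in \<open>[0, \<infinity>]\<close>, so that the supremum is meaningful without
  any boundedness assumption.
\<close>

definition frac_maximal ::
    "nat \<Rightarrow> real \<Rightarrow> (nat \<Rightarrow> real ^ 'n \<Rightarrow> complex) \<Rightarrow> real ^ 'n \<Rightarrow> ennreal" where
  "frac_maximal m \<beta> f x =
     (SUP Q \<in> {Q \<in> cubes. x \<in> Q}.
        ennreal (measure lebesgue Q powr (\<beta> / real CARD('n))) *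
        (\<Prod>i<m. (\<integral>\<^sup>+ y \<in> Q. ennreal (norm (f i y)) \<partial>lebesgue) / emeasure lebesgue Q))"

definition ennreal_sqrt :: "ennreal \<Rightarrow> ennreal" where
  "ennreal_sqrt t = (if t = \<infinity> then \<infinity> else ennreal (sqrt (enn2real t)))"

definition bounded_compact_support :: "(real ^ 'n \<Rightarrow> complex) \<Rightarrow> bool" where
  "bounded_compact_support g \<longleftrightarrow>
     g \<in> borel_measurable lebesgue \<and> bounded (range g) \<and> compact (closure {y. g y \<noteq> 0})"

end

theory Submission
  imports Defs
begin

text \<open>
  Split the kernel dyadically around a scale \<open>s > 0\<close>. On the shell where
  \<open>\<Sum>i |x - y\<^sub>i|\<close> is comparable to \<open>t\<close>, every \<open>y\<^sub>i\<close> lies in a cube of side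
  comparable to \<open>t\<close> around \<open>x\<close>, so that the shell contributes at most a constant times
  \<open>t\<^sup>\<alpha>\<^sup>-\<^sup>\<beta>\<close> times the maximal function of order \<open>\<beta>\<close>. Taking \<open>\<beta> = \<alpha> - \<epsilon>\<close> below the
  scale \<open>s\<close> and \<open>\<beta> = \<alpha> + \<epsilon>\<close> above it gives two geometric series; the resulting bound is
  then optimised in \<open>s\<close>. Both maximal functions vanish simultaneously, so their product is never
  the degenerate \<open>0 * \<infinity> = 0\<close>.
\<close>

section \<open>Dyadic scales and geometric series\<close>

lemma dyadic_scale:
  fixes s D :: real
  assumes "s > 0" "D > 0"
  obtains k :: nat where
      "s * 2 powr (- real k - 1) < D" "D \<le> 2 * (s * 2 powr (- real k - 1))"
    | k :: nat where "s * 2 powr real k < D" "D \<le> 2 * (s * 2 powr real k)"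
proof -
  \<comment> \<open>Ceiling minus one, rather than floor, yields shells open below and closed above:
    s 2^j < D \<le> s 2^(j+1).\<close>
  define j where "j = \<lceil>log 2 (D / s)\<rceil> - 1"
  have "real_of_int j < log 2 (D / s)" "log 2 (D / s) \<le> real_of_int j + 1"
    unfolding j_def by linarith+
  hence "2 powr real_of_int j < D / s" "D / s \<le> 2 powr (real_of_int j + 1)"
    using assms by (simp_all add: less_log_iff log_le_iff)
  hence *: "s * 2 powr real_of_int j < D" "D \<le> 2 * (s * 2 powr real_of_int j)"
    unfolding powr_add using assms by (simp_all add: pos_less_divide_eq pos_divide_le_eq mult_ac)
  show thesis
  proof (cases "j \<ge> 0")
    case True
    then obtain k where "j = int k"
      using nonneg_int_cases by blast
    thus thesis
      using that(2)[of k] * by simp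
  next
    case False
    \<comment> \<open>The shift by one starts the lower family at s/2, so that the scale s itself
      belongs to the upper family only.\<close>
    hence "0 \<le> - j - 1"
      by simp
    then obtain k where "- j - 1 = int k"
      using nonneg_int_cases by blast
    hence "j = - int k - 1"
      by simp
    thus thesis
      using that(1)[of k] * by simp
  qed
qed

text \<open>Both series are geometric with ratio 2^(-\<epsilon>) < 1. They sum the weights that the
  shells receive below s, where t^\<epsilon> decays as t shrinks, and above s, where t^(-\<epsilon>)
  decays as t grows.\<close>

lemma suminf_geometric_powr:
  fixes s \<epsilon> :: real
  assumes "s > 0" "\<epsilon> > 0"
  shows "(\<Sum>k. ennreal ((s * 2 powr (- real k - 1)) powr \<epsilon>)) \<le> ennreal (s powr \<epsilon> / (1 - 2 powr - \<epsilon>))"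
    and "(\<Sum>k. ennreal ((s * 2 powr real k) powr - \<epsilon>)) = ennreal (s powr - \<epsilon> / (1 - 2 powr - \<epsilon>))"
proof -
  define q :: real where "q = 2 powr - \<epsilon>"
  have q: "0 < q" "q < 1"
    using assms by (auto simp: q_def powr_less_one)
  have qk: "q ^ k = 2 powr (- \<epsilon> * real k)" for k
    by (simp add: q_def powr_power mult.commute)
  have geo: "(\<Sum>k. ennreal (c * q ^ k)) = ennreal (c / (1 - q))" if "c \<ge> 0" for c
    using sums_mult[OF geometric_sums[of q], of c] q that by (intro suminf_ennreal_eq) auto
  have "(s * 2 powr (- real k - 1)) powr \<epsilon> = s powr \<epsilon> * q * q ^ k" for k
  proof -
    have "(- real k - 1) * \<epsilon> = - \<epsilon> + - \<epsilon> * real k"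
      by (simp add: algebra_simps)
    hence "(s * 2 powr (- real k - 1)) powr \<epsilon> = s powr \<epsilon> * 2 powr (- \<epsilon> + - \<epsilon> * real k)"
      using assms by (simp only: powr_mult powr_powr)
    thus ?thesis
      unfolding qk powr_add by (simp add: q_def)
  qed
  hence "(\<Sum>k. ennreal ((s * 2 powr (- real k - 1)) powr \<epsilon>)) = ennreal (s powr \<epsilon> * q / (1 - q))"
    using geo[of "s powr \<epsilon> * q"] q by (simp only: mult_nonneg_nonneg powr_ge_zero less_imp_le)
  \<comment> \<open>The lower family starts at s/2, which leaves an extra factor \<open>q\<close>;
    discarding it gives both series the same constant.\<close>
  also have "\<dots> \<le> ennreal (s powr \<epsilon> / (1 - q))"
    using q by (intro ennreal_leI divide_right_mono mult_right_le_one_le) auto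
  finally show "(\<Sum>k. ennreal ((s * 2 powr (- real k - 1)) powr \<epsilon>)) \<le> ennreal (s powr \<epsilon> / (1 - 2 powr - \<epsilon>))"
    unfolding q_def .
  have "(s * 2 powr real k) powr - \<epsilon> = s powr - \<epsilon> * q ^ k" for k
  proof -
    have "real k * - \<epsilon> = - \<epsilon> * real k"
      by simp
    thus ?thesis
      unfolding qk using assms by (simp only: powr_mult powr_powr)
  qed
  thus "(\<Sum>k. ennreal ((s * 2 powr real k) powr - \<epsilon>)) = ennreal (s powr - \<epsilon> / (1 - 2 powr - \<epsilon>))"
    using geo[of "s powr - \<epsilon>"] by (simp only: powr_ge_zero q_def)
qed

section \<open>Cubes around a point and the maximal function\<close>

definition centred_cube :: "real ^ 'n \<Rightarrow> real \<Rightarrow> (real ^ 'n) set" where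
  "centred_cube x t = cbox (x - vec t) (x + vec t)"

lemma centred_cube_in_cubes:
  assumes "t > 0"
  shows "centred_cube x t \<in> cubes"
proof -
  have "x + vec t = (x - vec t) + vec (2 * t)"
    by (simp add: vec_eq_iff)
  thus ?thesis
    using assms unfolding cubes_def centred_cube_def
    by (metis (mono_tags, lifting) mem_Collect_eq mult_pos_pos zero_less_numeral)
qed

lemma mem_centred_cube:
  assumes "norm (x - y) \<le> t"
  shows "y \<in> centred_cube x t"
proof -
  have "\<bar>x $ i - y $ i\<bar> \<le> t" for i
    using component_le_norm_cart[of "x - y" i] assms by simp
  thus ?thesis
    by (auto simp: centred_cube_def mem_box_cart abs_le_iff algebra_simps)
qed

lemma measurable_centred_cube [measurable]: "centred_cube x t \<in> sets lebesgue"
  by (simp add: centred_cube_def)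

lemma measure_cube:
  fixes a :: "real ^ 'n"
  assumes "h \<ge> 0"
  shows "measure lebesgue (cbox a (a + vec h)) = h ^ CARD('n)"
  using assms by (subst measure_completion) (simp_all add: content_cbox_if_cart interval_eq_empty_cart)

lemma emeasure_cube:
  fixes a :: "real ^ 'n"
  assumes "h \<ge> 0"
  shows "emeasure lebesgue (cbox a (a + vec h)) = ennreal (h ^ CARD('n))"
  using measure_cube[OF assms, of a]
  by (metis emeasure_eq_ennreal_measure fmeasurableD2 lmeasurable_cbox top.not_eq_extremum)

text \<open>This is the integral of the tensor product of the |f_i| over Q^m. Being free of the
  order \<beta>, it links the maximal functions of different orders.\<close>

definition cube_mass :: "nat \<Rightarrow> (nat \<Rightarrow> real ^ 'n \<Rightarrow> complex) \<Rightarrow> (real ^ 'n) set \<Rightarrow> ennreal" where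
  "cube_mass m f Q = (\<Prod>i<m. \<integral>\<^sup>+ y \<in> Q. ennreal (norm (f i y)) \<partial>lebesgue)"

lemma prod_divide_const_ennreal:
  fixes g :: "nat \<Rightarrow> ennreal"
  assumes "c > 0"
  shows "(\<Prod>i<m. g i / ennreal c) = ennreal (c powr - real m) * (\<Prod>i<m. g i)"
proof -
  have "g i / ennreal c = ennreal (inverse c) * g i" for i
    using assms by (simp add: divide_ennreal_def inverse_ennreal mult.commute)
  thus ?thesis
    using assms by (simp add: prod.distrib ennreal_power powr_minus powr_realpow power_inverse)
qed

text \<open>The volume is h^n, so the prefactor gives h^\<beta> and each of the m averages gives
  h^(-n). The order \<beta> survives only in a positive scalar.\<close>

lemma cube_average:
  fixes f :: "nat \<Rightarrow> real ^ 'n \<Rightarrow> complex"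
  assumes "h > 0" and Q: "Q = cbox a (a + vec h)"
  shows "ennreal (measure lebesgue Q powr (\<beta> / real CARD('n))) *
        (\<Prod>i<m. (\<integral>\<^sup>+ y \<in> Q. ennreal (norm (f i y)) \<partial>lebesgue) / emeasure lebesgue Q)
      = ennreal (h powr (\<beta> - real CARD('n) * real m)) * cube_mass m f Q"
proof -
  let ?n = "CARD('n)"
  have h: "h ^ ?n = h powr real ?n"
    using assms by (simp add: powr_realpow)
  have "ennreal (measure lebesgue Q powr (\<beta> / real ?n)) *
        (\<Prod>i<m. (\<integral>\<^sup>+ y \<in> Q. ennreal (norm (f i y)) \<partial>lebesgue) / emeasure lebesgue Q)
      = ennreal ((h ^ ?n) powr (\<beta> / real ?n)) * (ennreal ((h ^ ?n) powr - real m) * cube_mass m f Q)"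
    unfolding cube_mass_def Q using assms(1)
    by (subst prod_divide_const_ennreal[symmetric])
      (simp_all add: measure_cube emeasure_cube del: emeasure_completion measure_completion)
  also have "\<dots> = ennreal ((h ^ ?n) powr (\<beta> / real ?n) * (h ^ ?n) powr - real m) * cube_mass m f Q"
    by (simp add: ennreal_mult mult.assoc)
  also have "(h ^ ?n) powr (\<beta> / real ?n) * (h ^ ?n) powr - real m = h powr (\<beta> - real ?n * real m)"
    unfolding h by (simp add: powr_powr flip: powr_add)
  finally show ?thesis .
qed

text \<open>The centred cube, of side 2t, is one of the competitors in the supremum; its power of
  the side is then moved to the other side of the inequality.\<close>

lemma cube_mass_le_frac_maximal:
  fixes x :: "real ^ 'n"
  assumes "t > 0"
  shows "cube_mass m f (centred_cube x t)
      \<le> ennreal ((2 * t) powr (real CARD('n) * real m - \<beta>)) * frac_maximal m \<beta> f x"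
proof -
  let ?Q = "centred_cube x t" and ?d = "real CARD('n) * real m - \<beta>"
  have Q: "?Q = cbox (x - vec t) ((x - vec t) + vec (2 * t))"
    unfolding centred_cube_def by (rule arg_cong2[of _ _ _ _ cbox]) (simp_all add: vec_eq_iff)
  have "x \<in> ?Q"
    using assms by (intro mem_centred_cube) simp
  hence "?Q \<in> {Q \<in> cubes. x \<in> Q}"
    using centred_cube_in_cubes[OF assms] by simp
  hence le: "ennreal ((2 * t) powr - ?d) * cube_mass m f ?Q \<le> frac_maximal m \<beta> f x"
    unfolding frac_maximal_def
    using cube_average[OF _ Q, where \<beta> = \<beta> and m = m and f = f] assms by (intro SUP_upper2[of ?Q]) auto
  \<comment> \<open>Inserting a product of powers equal to 1 replaces division in
    \<open>ennreal\<close>.\<close>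
  have "cube_mass m f ?Q = ennreal ((2 * t) powr ?d * (2 * t) powr - ?d) * cube_mass m f ?Q"
    using assms by (simp flip: powr_add)
  also have "\<dots> = ennreal ((2 * t) powr ?d) * (ennreal ((2 * t) powr - ?d) * cube_mass m f ?Q)"
    by (simp add: ennreal_mult mult.assoc)
  also have "\<dots> \<le> ennreal ((2 * t) powr ?d) * frac_maximal m \<beta> f x"
    by (intro mult_left_mono le) simp
  finally show ?thesis .
qed

text \<open>The scalar in front of the mass of each cube is positive, so it cannot affect vanishing.
  The criterion does not mention \<beta>, hence maximal functions of all orders vanish at the same
  points.\<close>

lemma frac_maximal_eq_0_iff:
  fixes x :: "real ^ 'n"
  shows "frac_maximal m \<beta> f x = 0 \<longleftrightarrow> (\<forall>Q\<in>cubes. x \<in> Q \<longrightarrow> cube_mass m f Q = 0)"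
proof -
  have "ennreal (measure lebesgue Q powr (\<beta> / real CARD('n))) *
        (\<Prod>i<m. (\<integral>\<^sup>+ y \<in> Q. ennreal (norm (f i y)) \<partial>lebesgue) / emeasure lebesgue Q) = 0
      \<longleftrightarrow> cube_mass m f Q = 0" if Q: "Q \<in> cubes" for Q
  proof -
    obtain a h where "h > 0" "Q = cbox a (a + vec h)"
      using Q unfolding cubes_def by blast
    thus ?thesis
      by (subst cube_average) (auto simp: ennreal_eq_0_iff)
  qed
  moreover have "frac_maximal m \<beta> f x = 0 \<longleftrightarrow> (\<forall>Q\<in>{Q \<in> cubes. x \<in> Q}.
      ennreal (measure lebesgue Q powr (\<beta> / real CARD('n))) *
        (\<Prod>i<m. (\<integral>\<^sup>+ y \<in> Q. ennreal (norm (f i y)) \<partial>lebesgue) / emeasure lebesgue Q) = 0)"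
    unfolding frac_maximal_def bot_ennreal[symmetric] by (rule SUP_bot_conv(1))
  ultimately show ?thesis
    by auto
qed

section \<open>Domination of the kernel by dyadic shells and integration over the product
  space\<close>

lemma sigma_finite_lebesgue: "sigma_finite_measure lebesgue"
proof
  \<comment> \<open>A countable Borel cover by sets of finite measure also serves for the
    completion, which agrees with \<open>lborel\<close> on Borel sets.\<close>
  obtain A :: "'a set set" where A: "countable A" "A \<subseteq> sets lborel" "\<Union>A = space lborel"
      "\<forall>a\<in>A. emeasure lborel a \<noteq> \<infinity>"
    using sigma_finite_measure.sigma_finite_countable[OF sigma_finite_lborel] by blast
  thus "\<exists>A::'a set set. countable A \<and> A \<subseteq> sets lebesgue \<and> \<Union>A = space lebesgue \<and>
      (\<forall>a\<in>A. emeasure lebesgue a \<noteq> \<infinity>)"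
    by (intro exI[of _ A]) auto
qed

text \<open>Tonelli: the integrand is a product of functions of separate variables.\<close>

lemma nn_integral_prod_indicator_eq_cube_mass:
  fixes f :: "nat \<Rightarrow> real ^ 'n \<Rightarrow> complex"
  assumes "\<And>i. i < m \<Longrightarrow> f i \<in> borel_measurable lebesgue" and [measurable]: "Q \<in> sets lebesgue"
  shows "(\<integral>\<^sup>+ y. (\<Prod>i<m. ennreal (norm (f i (y i))) * indicator Q (y i)) \<partial>Pi\<^sub>M {..<m} (\<lambda>_. lebesgue))
      = cube_mass m f Q"
proof -
  interpret product_sigma_finite "\<lambda>_::nat. lebesgue :: (real ^ 'n) measure"
    by (simp add: product_sigma_finite_def sigma_finite_lebesgue)
  show ?thesis
    unfolding cube_mass_def using assms
    by (subst product_nn_integral_prod) auto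
qed

text \<open>On the shell every |x - y_i| is at most the whole sum, hence at most 2t, so all
  indicators equal 1. The kernel decreases in the sum, so it is at most its value at t.\<close>

lemma kernel_shell_le:
  fixes f :: "nat \<Rightarrow> real ^ 'n \<Rightarrow> complex"
  assumes "N > 0" "t > 0" and t: "t < (\<Sum>i<m. norm (x - y i))" "(\<Sum>i<m. norm (x - y i)) \<le> 2 * t"
  shows "ennreal (norm ((\<Prod>i<m. f i (y i)) / of_real ((\<Sum>i<m. norm (x - y i)) powr N)))
      \<le> ennreal (t powr - N) *
        (\<Prod>i<m. ennreal (norm (f i (y i))) * indicator (centred_cube x (2 * t)) (y i))"
proof -
  let ?D = "\<Sum>i<m. norm (x - y i)"
  have "y i \<in> centred_cube x (2 * t)" if "i < m" for i
    using that member_le_sum[of i "{..<m}" "\<lambda>i. norm (x - y i)"] t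
    by (intro mem_centred_cube) auto
  hence "(\<Prod>i<m. ennreal (norm (f i (y i))) * indicator (centred_cube x (2 * t)) (y i))
      = (\<Prod>i<m. ennreal (norm (f i (y i))))"
    by (intro prod.cong) auto
  also have "\<dots> = ennreal (\<Prod>i<m. norm (f i (y i)))"
    by (simp add: prod_ennreal)
  finally have G: "(\<Prod>i<m. ennreal (norm (f i (y i))) * indicator (centred_cube x (2 * t)) (y i))
      = ennreal (\<Prod>i<m. norm (f i (y i)))" .
  have "norm ((\<Prod>i<m. f i (y i)) / of_real (?D powr N)) = ?D powr - N * (\<Prod>i<m. norm (f i (y i)))"
    unfolding prod_norm norm_divide norm_of_real by (simp add: powr_minus divide_inverse mult.commute)
  also have "\<dots> \<le> t powr - N * (\<Prod>i<m. norm (f i (y i)))"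
    using assms by (intro mult_right_mono powr_mono2' prod_nonneg) auto
  finally show ?thesis
    unfolding G by (simp add: ennreal_mult[symmetric] prod_nonneg ennreal_leI)
qed

text \<open>Each y with positive sum lies in some shell, and the term of that shell alone already
  dominates, all other terms being nonnegative.\<close>

lemma kernel_le_dyadic_sums:
  fixes f :: "nat \<Rightarrow> real ^ 'n \<Rightarrow> complex" and x :: "real ^ 'n" and m :: nat and N s :: real
  assumes "N > 0" "s > 0"
  defines "G \<equiv> \<lambda>t y. ennreal (t powr - N) *
        (\<Prod>i<m. ennreal (norm (f i (y i))) * indicator (centred_cube x (2 * t)) (y i))"
  shows "ennreal (norm ((\<Prod>i<m. f i (y i)) / of_real ((\<Sum>i<m. norm (x - y i)) powr N)))
      \<le> (\<Sum>k. G (s * 2 powr (- real k - 1)) y) + (\<Sum>k. G (s * 2 powr real k) y)"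
    (is "?F \<le> ?A + ?B")
proof (cases "(\<Sum>i<m. norm (x - y i)) = 0")
  case True
  \<comment> \<open>Here the denominator is \<open>0 powr N = 0\<close>, and division by zero gives
    0.\<close>
  show ?thesis
    unfolding True by simp
next
  case False
  moreover have "(\<Sum>i<m. norm (x - y i)) \<ge> 0"
    by (intro sum_nonneg) auto
  ultimately have "(\<Sum>i<m. norm (x - y i)) > 0"
    by linarith
  from \<open>s > 0\<close> this show ?thesis
  proof (cases rule: dyadic_scale)
    case (1 k)
    have "?F \<le> G (s * 2 powr (- real k - 1)) y"
      unfolding G_def using assms 1 by (intro kernel_shell_le) auto
    also have "\<dots> \<le> ?A"
      using sum_le_suminf[OF summableI, of "{k}" "\<lambda>k. G (s * 2 powr (- real k - 1)) y"] by simp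
    finally show ?thesis
      by (rule order_trans) simp
  next
    case (2 k)
    have "?F \<le> G (s * 2 powr real k) y"
      unfolding G_def using assms 2 by (intro kernel_shell_le) auto
    also have "\<dots> \<le> ?B"
      using sum_le_suminf[OF summableI, of "{k}" "\<lambda>k. G (s * 2 powr real k) y"] by simp
    finally show ?thesis
      by (rule order_trans) simp
  qed
qed

text \<open>The Bochner integral of a non-integrable function is 0 by default, so the bound can be
  applied to the kernel before anything is known about its integrability.\<close>

lemma ennreal_norm_integral_le_nn_integral:
  fixes g :: "'a \<Rightarrow> 'b::{banach, second_countable_topology}"
  shows "ennreal (norm (integral\<^sup>L M g)) \<le> (\<integral>\<^sup>+ y. ennreal (norm (g y)) \<partial>M)"
  by (cases "integrable M g") (auto simp: integral_norm_bound_ennreal not_integrable_integral_eq)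

lemma frac_integral_le_dyadic_sums:
  fixes f :: "nat \<Rightarrow> real ^ 'n \<Rightarrow> complex" and x :: "real ^ 'n" and m :: nat and \<alpha> s :: real
  assumes "\<alpha> < real CARD('n) * real m" "s > 0"
    and meas: "\<And>i. i < m \<Longrightarrow> f i \<in> borel_measurable lebesgue"
  defines "A \<equiv> \<lambda>t. ennreal (t powr (\<alpha> - real CARD('n) * real m)) * cube_mass m f (centred_cube x (2 * t))"
  shows "ennreal (norm (frac_integral m \<alpha> f x))
      \<le> (\<Sum>k. A (s * 2 powr (- real k - 1))) + (\<Sum>k. A (s * 2 powr real k))"
proof -
  let ?N = "real m * real CARD('n) - \<alpha>" and ?M = "Pi\<^sub>M {..<m} (\<lambda>_. lebesgue :: (real ^ 'n) measure)"
  have N: "?N > 0" and N': "- ?N = \<alpha> - real CARD('n) * real m"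
    using assms by (simp_all add: mult.commute)
  define G where "G = (\<lambda>t y. ennreal (t powr - ?N) *
        (\<Prod>i<m. ennreal (norm (f i (y i))) * indicator (centred_cube x (2 * t)) (y i)))"
  have prod_meas: "(\<lambda>y. \<Prod>i<m. ennreal (norm (f i (y i))) * indicator (centred_cube x (2 * t)) (y i))
      \<in> borel_measurable ?M" for t
  proof (intro borel_measurable_prod_ennreal)
    fix i assume "i \<in> {..<m}"
    hence i: "(\<lambda>y. y i) \<in> measurable ?M lebesgue" and [measurable]: "f i \<in> borel_measurable lebesgue"
      by (auto intro: measurable_component_singleton meas)
    show "(\<lambda>y. ennreal (norm (f i (y i))) * indicator (centred_cube x (2 * t)) (y i)) \<in> borel_measurable ?M"
      by (rule measurable_compose[OF i]) measurable
  qed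
  hence G_meas [measurable]: "G t \<in> borel_measurable ?M" for t
    unfolding G_def by (intro borel_measurable_times_ennreal borel_measurable_const prod_meas)
  have G_int: "(\<integral>\<^sup>+ y. G t y \<partial>?M) = A t" for t
    unfolding G_def A_def N'[symmetric]
    by (simp add: nn_integral_cmult prod_meas nn_integral_prod_indicator_eq_cube_mass meas)
  have "ennreal (norm (frac_integral m \<alpha> f x))
      \<le> (\<integral>\<^sup>+ y. ennreal (norm ((\<Prod>i<m. f i (y i)) / of_real ((\<Sum>i<m. norm (x - y i)) powr ?N))) \<partial>?M)"
    unfolding frac_integral_def by (rule ennreal_norm_integral_le_nn_integral)
  also have "\<dots> \<le> (\<integral>\<^sup>+ y. (\<Sum>k. G (s * 2 powr (- real k - 1)) y) + (\<Sum>k. G (s * 2 powr real k) y) \<partial>?M)"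
    unfolding G_def using N \<open>s > 0\<close> by (intro nn_integral_mono kernel_le_dyadic_sums)
  \<comment> \<open>Monotone convergence exchanges the series with the integral; each term then
    factors by Tonelli.\<close>
  also have "\<dots> = (\<Sum>k. A (s * 2 powr (- real k - 1))) + (\<Sum>k. A (s * 2 powr real k))"
    by (simp add: nn_integral_add nn_integral_suminf G_int)
  finally show ?thesis .
qed

text \<open>Shells below s are estimated with order \<alpha> - \<epsilon> and shells above s with
  order \<alpha> + \<epsilon>, so both series converge. In \<open>K\<close>, the 4 arises because
  the shell at scale t uses a cube of side 4t, and the denominator is that of the geometric
  series.\<close>

lemma frac_integral_le_two_scales:
  fixes f :: "nat \<Rightarrow> real ^ 'n \<Rightarrow> complex" and x :: "real ^ 'n" and m :: nat and \<alpha> \<epsilon> s :: real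
  assumes "\<alpha> < real CARD('n) * real m" "s > 0" "\<epsilon> > 0"
    and meas: "\<And>i. i < m \<Longrightarrow> f i \<in> borel_measurable lebesgue"
  defines "K \<equiv> 4 powr (real CARD('n) * real m - \<alpha> + \<epsilon>) / (1 - 2 powr - \<epsilon>)"
  shows "ennreal (norm (frac_integral m \<alpha> f x))
      \<le> ennreal K * (ennreal (s powr \<epsilon>) * frac_maximal m (\<alpha> - \<epsilon>) f x
                    + ennreal (s powr - \<epsilon>) * frac_maximal m (\<alpha> + \<epsilon>) f x)"
proof -
  let ?N = "real CARD('n) * real m - \<alpha>"
  let ?c = "ennreal (4 powr (?N + \<epsilon>))" and ?L = "frac_maximal m (\<alpha> - \<epsilon>) f x" and ?H = "frac_maximal m (\<alpha> + \<epsilon>) f x"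
  define A where "A = (\<lambda>t. ennreal (t powr (\<alpha> - real CARD('n) * real m)) * cube_mass m f (centred_cube x (2 * t)))"
  have A: "A t \<le> ?c * ennreal (t powr (\<alpha> - \<beta>)) * frac_maximal m \<beta> f x"
    if "t > 0" "\<beta> \<ge> \<alpha> - \<epsilon>" for t \<beta>
  proof -
    have "A t \<le> ennreal (t powr - ?N) * (ennreal ((2 * (2 * t)) powr (?N + \<alpha> - \<beta>)) * frac_maximal m \<beta> f x)"
      unfolding A_def using cube_mass_le_frac_maximal[of "2 * t" m f x \<beta>] that
      by (intro mult_mono) auto
    also have "\<dots> = ennreal (t powr - ?N * (4 * t) powr (?N + \<alpha> - \<beta>)) * frac_maximal m \<beta> f x"
      by (simp add: ennreal_mult mult.assoc)
    also have "t powr - ?N * (4 * t) powr (?N + \<alpha> - \<beta>)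
        = 4 powr (?N + \<alpha> - \<beta>) * (t powr - ?N * t powr (?N + \<alpha> - \<beta>))"
      using that by (simp add: powr_mult)
    also have "t powr - ?N * t powr (?N + \<alpha> - \<beta>) = t powr (\<alpha> - \<beta>)"
      unfolding powr_add[symmetric] by simp
    \<comment> \<open>As \<beta> \<ge> \<alpha> - \<epsilon>, the exponent of 4 is at most
      \<open>?N + \<epsilon>\<close>; one constant thus serves both orders.\<close>
    also have "ennreal (4 powr (?N + \<alpha> - \<beta>) * t powr (\<alpha> - \<beta>))
        \<le> ennreal (4 powr (?N + \<epsilon>) * t powr (\<alpha> - \<beta>))"
      using that by (intro ennreal_leI mult_right_mono powr_mono) auto
    finally show ?thesis
      by (simp add: ennreal_mult mult_right_mono)
  qed
  have geo: "1 - 2 powr - \<epsilon> > 0"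
    using assms by (simp add: powr_less_one)
  have K: "?c * ennreal (a / (1 - 2 powr - \<epsilon>)) = ennreal K * ennreal a" if "a \<ge> 0" for a
    using that geo unfolding K_def by (simp flip: ennreal_mult)
  have "(\<Sum>k. A (s * 2 powr (- real k - 1)))
      \<le> (\<Sum>k. ?c * ennreal ((s * 2 powr (- real k - 1)) powr \<epsilon>) * ?L)"
    using A[of _ "\<alpha> - \<epsilon>"] assms by (intro suminf_le summableI) simp
  also have "\<dots> = ?c * (\<Sum>k. ennreal ((s * 2 powr (- real k - 1)) powr \<epsilon>)) * ?L"
    by simp
  also have "\<dots> \<le> ?c * ennreal (s powr \<epsilon> / (1 - 2 powr - \<epsilon>)) * ?L"
    using assms by (intro mult_right_mono mult_left_mono suminf_geometric_powr) auto
  finally have low: "(\<Sum>k. A (s * 2 powr (- real k - 1))) \<le> ennreal K * ennreal (s powr \<epsilon>) * ?L"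
    by (simp add: K)
  have "(\<Sum>k. A (s * 2 powr real k)) \<le> (\<Sum>k. ?c * ennreal ((s * 2 powr real k) powr - \<epsilon>) * ?H)"
    using A[of _ "\<alpha> + \<epsilon>"] assms by (intro suminf_le summableI) simp
  also have "\<dots> = ?c * (\<Sum>k. ennreal ((s * 2 powr real k) powr - \<epsilon>)) * ?H"
    by simp
  also have "\<dots> = ennreal K * ennreal (s powr - \<epsilon>) * ?H"
    unfolding suminf_geometric_powr(2)[OF assms(2,3)] by (simp add: K)
  finally have high: "(\<Sum>k. A (s * 2 powr real k)) \<le> ennreal K * ennreal (s powr - \<epsilon>) * ?H" .
  have "ennreal (norm (frac_integral m \<alpha> f x))
      \<le> (\<Sum>k. A (s * 2 powr (- real k - 1))) + (\<Sum>k. A (s * 2 powr real k))"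
    unfolding A_def by (intro frac_integral_le_dyadic_sums assms)
  also have "\<dots> \<le> ennreal K * ennreal (s powr \<epsilon>) * ?L + ennreal K * ennreal (s powr - \<epsilon>) * ?H"
    by (intro add_mono low high)
  finally show ?thesis
    by (simp add: distrib_left mult.assoc)
qed

section \<open>Optimisation of the scale and conclusion\<close>

lemma balanced_scale:
  fixes a b \<epsilon> :: real
  assumes "a > 0" "b > 0" "\<epsilon> > 0"
  obtains s where "s > 0" "s powr \<epsilon> * a = sqrt (a * b)" "s powr - \<epsilon> * b = sqrt (a * b)"
proof
  \<comment> \<open>This solves s^\<epsilon> a = s^(-\<epsilon>) b, that is s^(2\<epsilon>) = b/a;
    the common value is the geometric mean of a and b.\<close>
  let ?s = "(b / a) powr (1 / (2 * \<epsilon>))"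
  have s: "?s powr \<epsilon> = sqrt b / sqrt a"
    using assms by (simp add: powr_powr powr_half_sqrt real_sqrt_divide)
  show "?s > 0"
    using assms by simp
  show "?s powr \<epsilon> * a = sqrt (a * b)"
    unfolding s using assms by (simp add: real_sqrt_mult field_simps)
  show "?s powr - \<epsilon> * b = sqrt (a * b)"
    unfolding powr_minus s using assms by (simp add: real_sqrt_mult field_simps)
qed

theorem theorem2p26:
  fixes m :: nat and \<alpha> \<epsilon> :: real
  assumes "m \<ge> 1"
    and "0 < \<alpha>" and "\<alpha> < real CARD('n::finite) * real m"
    and "0 < \<epsilon>" and "\<epsilon> < min \<alpha> (real CARD('n) * real m - \<alpha>)"
  shows "\<exists>C::real. C > 0 \<and>
    (\<forall>(f :: nat \<Rightarrow> real ^ 'n \<Rightarrow> complex) (x :: real ^ 'n).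
       (\<forall>i<m. bounded_compact_support (f i)) \<longrightarrow>
       ennreal (norm (frac_integral m \<alpha> f x))
         \<le> ennreal C * ennreal_sqrt (frac_maximal m (\<alpha> + \<epsilon>) f x * frac_maximal m (\<alpha> - \<epsilon>) f x))"
proof -
  define K where "K = 4 powr (real CARD('n) * real m - \<alpha> + \<epsilon>) / (1 - 2 powr - \<epsilon>)"
  have "2 powr - \<epsilon> < 1"
    using assms by (simp add: powr_less_one)
  hence K: "K > 0"
    by (simp add: K_def)
  show ?thesis
  \<comment> \<open>The factor 2 counts the two terms, which become equal at the balanced
    scale.\<close>
  proof (intro exI[of _ "2 * K"] conjI allI impI)
    show "2 * K > 0" using K by simp
    fix f :: "nat \<Rightarrow> real ^ 'n \<Rightarrow> complex" and x :: "real ^ 'n"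
    assume f: "\<forall>i<m. bounded_compact_support (f i)"
    let ?I = "ennreal (norm (frac_integral m \<alpha> f x))"
    let ?H = "frac_maximal m (\<alpha> + \<epsilon>) f x" and ?L = "frac_maximal m (\<alpha> - \<epsilon>) f x"
    have bound: "?I \<le> ennreal K * (ennreal (s powr \<epsilon>) * ?L + ennreal (s powr - \<epsilon>) * ?H)" if "s > 0" for s
      unfolding K_def using assms f that
      by (intro frac_integral_le_two_scales) (auto simp: bounded_compact_support_def)
    have zero_iff: "?H = 0 \<longleftrightarrow> ?L = 0"
      by (simp add: frac_maximal_eq_0_iff)
    consider "?H = 0" "?L = 0" | "?H \<noteq> 0" "?L \<noteq> 0" "?H = \<infinity> \<or> ?L = \<infinity>"
      | "?H \<noteq> 0" "?L \<noteq> 0" "?H \<noteq> \<infinity>" "?L \<noteq> \<infinity>"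
      using zero_iff by blast
    thus "?I \<le> ennreal (2 * K) * ennreal_sqrt (?H * ?L)"
    proof cases
      case 1
      \<comment> \<open>Any scale would do: both terms of the bound vanish, so the integral is
        0.\<close>
      thus ?thesis using bound[of 1] by simp
    next
      case 2
      \<comment> \<open>Neither factor is 0, so the product is infinite; since K > 0, the right-hand
        side is infinite as well.\<close>
      hence "?H * ?L = \<infinity>" by (auto simp: ennreal_mult_eq_top_iff)
      thus ?thesis using K by (simp add: ennreal_sqrt_def ennreal_mult_top)
    next
      case 3
      \<comment> \<open>Both values are now positive and finite, as the balanced scale
        requires.\<close>
      obtain h where h: "?H = ennreal h" "h > 0"
        using 3 by (cases ?H) (auto simp: less_le)
      obtain l where l: "?L = ennreal l" "l > 0"
        using 3 by (cases ?L) (auto simp: less_le)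
      obtain s where s: "s > 0" "s powr \<epsilon> * l = sqrt (l * h)" "s powr - \<epsilon> * h = sqrt (l * h)"
        using balanced_scale[OF l(2) h(2) \<open>0 < \<epsilon>\<close>] .
      have "?I \<le> ennreal (K * (s powr \<epsilon> * l + s powr - \<epsilon> * h))"
        using bound[OF s(1)] h l K
        by (simp flip: ennreal_mult ennreal_plus)
      also have "\<dots> = ennreal (2 * K) * ennreal (sqrt (l * h))"
        unfolding s using K h l by (simp flip: ennreal_mult)
      also have "ennreal (sqrt (l * h)) = ennreal_sqrt (?H * ?L)"
        using h l by (simp add: ennreal_sqrt_def mult.commute flip: ennreal_mult)
      finally show ?thesis .
    qed
  qed
qed

end
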